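(* For every finite-dimensional real normed vector space $(V, \|\cdot\|)$, the space $\operatorname{Net}_H(V)$ of all $\varepsilon$-nets in $V$, equipped with the Hausdorff distance, is contractible.
   Context: $V$ is regarded as a metric space with distance $\|x-y\|$. An $\varepsilon$-net in a metric space $X$ is a non-empty subset $A\subset X$ such that every point of $X$ is at distance at most $\varepsilon$ from some point of $A$; "the space of all $\varepsilon$-nets" means the set of all subsets that are $\varepsilon$-nets for some $\varepsilon>0$ (with $\varepsilon$ depending on the subset), i.e. all non-empty $A\subset X$ with $d_H(A,X)<\infty$. For non-empty subsets $A,B$ of a metric space, the Hausdorff distance is $d_H(A,B)=\max\bigl(\sup_{a\in A}\inf_{b\in B}|ab|,\ \sup_{b\in B}\inf_{a\in A}|ab|\bigr)$. $\operatorname{Net}_H(V)$ carries the topology induced by the (pseudo)metric $d_H$; contractible means that the identity map is homotopic to a constant map. *)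

theory Defs
  imports "HOL-Analysis.Analysis"
begin

text \<open>The suprema and infima are taken in the extended reals, so that the distance of two
  non-empty sets may be \<open>\<infinity>\<close>. For empty arguments the value is meaningless.\<close>

definition hausdorff_dist :: "'a::metric_space set \<Rightarrow> 'a set \<Rightarrow> ereal" where
  "hausdorff_dist A B =
     max (SUP a\<in>A. INF b\<in>B. ereal (dist a b)) (SUP b\<in>B. INF a\<in>A. ereal (dist a b))"

definition eps_net :: "real \<Rightarrow> 'a::metric_space set \<Rightarrow> bool" where
  "eps_net \<epsilon> A \<longleftrightarrow> A \<noteq> {} \<and> (\<forall>x. \<exists>a\<in>A. dist x a \<le> \<epsilon>)"

definition nets :: "'a::metric_space set set" where
  "nets = {A. \<exists>\<epsilon>>0. eps_net \<epsilon> A}"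

lemma nets_iff_hausdorff_dist:
  "A \<in> nets \<longleftrightarrow> A \<noteq> {} \<and> hausdorff_dist A UNIV < \<infinity>"
proof
  assume "A \<in> nets"
  then obtain e where e: "e > 0" "A \<noteq> {}" "\<And>x. \<exists>a\<in>A. dist x a \<le> e"
    by (auto simp: nets_def eps_net_def)
  have "(SUP a\<in>A. INF b\<in>UNIV. ereal (dist a b)) \<le> ereal e"
  proof (rule SUP_least)
    fix a assume "a \<in> A"
    show "(INF b\<in>UNIV. ereal (dist a b)) \<le> ereal e"
      by (rule INF_lower2[of a]) (use e in auto)
  qed
  moreover have "(SUP b\<in>UNIV. INF a\<in>A. ereal (dist a b)) \<le> ereal e"
  proof (rule SUP_least)
    fix b :: 'a
    obtain a where "a \<in> A" "dist b a \<le> e" using e(3) by blast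
    then show "(INF a\<in>A. ereal (dist a b)) \<le> ereal e"
      by (intro INF_lower2[of a]) (auto simp: dist_commute)
  qed
  ultimately have "hausdorff_dist A UNIV \<le> ereal e"
    by (simp add: hausdorff_dist_def)
  then show "A \<noteq> {} \<and> hausdorff_dist A UNIV < \<infinity>"
    using e(2) by (auto intro: le_less_trans)
next
  assume A: "A \<noteq> {} \<and> hausdorff_dist A UNIV < \<infinity>"
  then obtain n :: nat where n: "hausdorff_dist A UNIV < ereal (real n)"
    using less_PInf_Ex_of_nat[of "hausdorff_dist A UNIV"] by auto
  have close: "\<exists>a\<in>A. dist x a \<le> real n + 1" for x
  proof -
    have "(INF a\<in>A. ereal (dist a x)) \<le> (SUP b\<in>UNIV. INF a\<in>A. ereal (dist a b))"
      by (rule SUP_upper) simp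
    also have "\<dots> \<le> hausdorff_dist A UNIV"
      by (simp add: hausdorff_dist_def)
    also note n
    finally obtain a where "a \<in> A" "dist a x < real n"
      by (auto simp: INF_less_iff)
    then show ?thesis
      by (intro bexI[of _ a]) (auto simp: dist_commute)
  qed
  then show "A \<in> nets"
    using A by (auto simp: nets_def eps_net_def intro!: exI[of _ "real n + 1"])
qed

text \<open>The topology induced by a pseudometric \<open>d\<close> on \<open>M\<close>. The type \<open>'a metric\<close> of the library is
  not applicable here: a set and its closure are distinct at Hausdorff distance 0.\<close>

definition pseudometric_topology :: "'b set \<Rightarrow> ('b \<Rightarrow> 'b \<Rightarrow> ereal) \<Rightarrow> 'b topology" where
  "pseudometric_topology M d =
     topology (\<lambda>U. U \<subseteq> M \<and> (\<forall>x\<in>U. \<exists>r>0. {y \<in> M. d x y < ereal r} \<subseteq> U))"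

lemma openin_pseudometric_topology:
  "openin (pseudometric_topology M d) U \<longleftrightarrow>
     U \<subseteq> M \<and> (\<forall>x\<in>U. \<exists>r>0. {y \<in> M. d x y < ereal r} \<subseteq> U)"
proof -
  let ?P = "\<lambda>U. U \<subseteq> M \<and> (\<forall>x\<in>U. \<exists>r>0. {y \<in> M. d x y < ereal r} \<subseteq> U)"
  have Int: "?P (S \<inter> T)" if S: "?P S" and T: "?P T" for S T
  proof (intro conjI ballI)
    fix x assume "x \<in> S \<inter> T"
    then obtain r s where r: "r > 0" "{y \<in> M. d x y < ereal r} \<subseteq> S"
      and s: "s > 0" "{y \<in> M. d x y < ereal s} \<subseteq> T"
      using S T by blast
    have "d x y < ereal r \<and> d x y < ereal s" if "d x y < ereal (min r s)" for y
      using less_le_trans[OF that, of "ereal r"] less_le_trans[OF that, of "ereal s"] by simp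
    then have "{y \<in> M. d x y < ereal (min r s)} \<subseteq> S \<inter> T"
      using r(2) s(2) by blast
    moreover have "min r s > 0"
      using r(1) s(1) by simp
    ultimately show "\<exists>r>0. {y \<in> M. d x y < ereal r} \<subseteq> S \<inter> T" by blast
  qed (use S in auto)
  have Un: "?P (\<Union>K)" if K: "\<And>U. U \<in> K \<Longrightarrow> ?P U" for K
  proof (intro conjI ballI)
    show "\<Union>K \<subseteq> M" using K by blast
  next
    fix x assume "x \<in> \<Union>K"
    then obtain U where U: "U \<in> K" "x \<in> U" by blast
    then obtain r where r: "r > 0" "{y \<in> M. d x y < ereal r} \<subseteq> U"
      using K[OF U(1)] by blast
    have "{y \<in> M. d x y < ereal r} \<subseteq> \<Union>K"
      using r(2) Union_upper[OF U(1)] by (rule subset_trans)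
    with r(1) show "\<exists>r>0. {y \<in> M. d x y < ereal r} \<subseteq> \<Union>K"
      by (intro exI[of _ r] conjI)
  qed
  have "istopology ?P"
    unfolding istopology_def
  proof (rule conjI; intro allI impI)
    show "?P (S \<inter> T)" if "?P S" "?P T" for S T using that by (rule Int)
    show "?P (\<Union>K)" if "\<forall>U\<in>K. ?P U" for K by (rule Un) (rule bspec[OF that])
  qed
  then show ?thesis
    by (simp add: pseudometric_topology_def topology_inverse')
qed

lemma topspace_pseudometric_topology [simp]: "topspace (pseudometric_topology M d) = M"
proof
  show "topspace (pseudometric_topology M d) \<subseteq> M"
    unfolding topspace_def by (auto simp: openin_pseudometric_topology)
  have "openin (pseudometric_topology M d) M"
    unfolding openin_pseudometric_topology by (auto intro: exI[of _ 1])
  then show "M \<subseteq> topspace (pseudometric_topology M d)"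
    by (rule openin_subset)
qed

definition Net_H :: "'a::metric_space set topology" where
  "Net_H = pseudometric_topology nets hausdorff_dist"

end

theory Submission
  imports Defs
begin

text \<open>Replace a net \<open>A\<close> by the union of the closed balls of radius \<open>s\<close> about its points and let
  \<open>s\<close> grow from 0 to \<open>\<infinity>\<close>. In a normed space this thickening moves the net by at most
  \<open>\<bar>s - s'\<bar>\<close> when the radius changes from \<open>s\<close> to \<open>s'\<close>, and it does not increase Hausdorff
  distances. Every net within distance 1 of a fixed \<open>\<epsilon>\<close>-net is an \<open>(\<epsilon> + 1)\<close>-net, so all its
  thickenings of radius at least \<open>\<epsilon> + 1\<close> are the whole space; therefore the homotopy remains
  continuous at \<open>s = \<infinity>\<close>, where it is constant.\<close>

lemma hausdorff_dist_le:
  assumes "\<And>a. a \<in> A \<Longrightarrow> \<exists>b\<in>B. dist a b \<le> e" "\<And>b. b \<in> B \<Longrightarrow> \<exists>a\<in>A. dist b a \<le> e"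
  shows "hausdorff_dist A B \<le> ereal e"
  unfolding hausdorff_dist_def
proof (intro max.boundedI SUP_least)
  fix a assume "a \<in> A"
  then obtain b where "b \<in> B" "dist a b \<le> e" using assms(1) by blast
  then show "(INF b\<in>B. ereal (dist a b)) \<le> ereal e" by (intro INF_lower2[of b]) auto
next
  fix b assume "b \<in> B"
  then obtain a where "a \<in> A" "dist b a \<le> e" using assms(2) by blast
  then show "(INF a\<in>A. ereal (dist a b)) \<le> ereal e"
    by (intro INF_lower2[of a]) (auto simp: dist_commute)
qed

lemma hausdorff_dist_commute: "hausdorff_dist A B = hausdorff_dist B A"
  by (simp add: hausdorff_dist_def dist_commute max.commute)

text \<open>The bound is strict because the infimum over \<open>B\<close> need not be attained; only
  a strict bound yields an actual point.\<close>

lemma hausdorff_dist_lessD: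
  assumes "hausdorff_dist A B < ereal r" "a \<in> A"
  shows "\<exists>b\<in>B. dist a b < r"
proof -
  have "(INF b\<in>B. ereal (dist a b)) \<le> hausdorff_dist A B"
    unfolding hausdorff_dist_def by (rule max.coboundedI1) (rule SUP_upper[OF assms(2)])
  with assms(1) have "(INF b\<in>B. ereal (dist a b)) < ereal r" by (rule order.strict_trans1[rotated])
  then show ?thesis by (auto simp: INF_less_iff)
qed

lemma hausdorff_dist_triangle_less:
  assumes "hausdorff_dist A B < ereal p" "hausdorff_dist B C < ereal q"
  shows "hausdorff_dist A C \<le> ereal (p + q)"
proof (rule hausdorff_dist_le)
  fix a assume "a \<in> A"
  then obtain b where "b \<in> B" "dist a b < p" using hausdorff_dist_lessD[OF assms(1)] by blast
  moreover from this obtain c where "c \<in> C" "dist b c < q"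
    using hausdorff_dist_lessD[OF assms(2)] by blast
  ultimately show "\<exists>c\<in>C. dist a c \<le> p + q"
    using dist_triangle[of a c b] by (intro bexI[of _ c]) auto
next
  fix c assume "c \<in> C"
  then obtain b where "b \<in> B" "dist c b < q"
    using hausdorff_dist_lessD assms(2) hausdorff_dist_commute by metis
  moreover from this obtain a where "a \<in> A" "dist b a < p"
    using hausdorff_dist_lessD assms(1) hausdorff_dist_commute by metis
  ultimately show "\<exists>a\<in>A. dist c a \<le> p + q"
    using dist_triangle[of c a b] by (intro bexI[of _ a]) auto
qed

lemma topspace_Net_H [simp]: "topspace Net_H = nets"
  by (simp add: Net_H_def)

text \<open>Openness of balls is not built into the topology; it rests on the triangle
  inequality.\<close>

lemma openin_Net_H_ball: "openin Net_H {B \<in> nets. hausdorff_dist A B < ereal r}"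
  unfolding Net_H_def openin_pseudometric_topology
proof (intro conjI ballI)
  fix B assume "B \<in> {B \<in> nets. hausdorff_dist A B < ereal r}"
  then obtain q where q: "hausdorff_dist A B < ereal q" "q < r"
    \<comment> \<open>The intermediate radius \<open>q\<close> absorbs the loss of strictness in the
      triangle inequality: \<open>q + (r - q) / 2 < r\<close>.\<close>
    using ereal_dense2[of "hausdorff_dist A B" "ereal r"] by auto
  have "hausdorff_dist A C < ereal r" if "hausdorff_dist B C < ereal ((r - q) / 2)" for C
    using hausdorff_dist_triangle_less[OF q(1) that] by (rule le_less_trans) (use q(2) in \<open>simp add: field_simps\<close>)
  then show "\<exists>s>0. {C \<in> nets. hausdorff_dist B C < ereal s} \<subseteq> {B \<in> nets. hausdorff_dist A B < ereal r}"
    using q(2) by (intro exI[of _ "(r - q) / 2"]) auto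
qed auto

lemma continuous_map_into_pseudometric_topology:
  assumes "\<And>x. x \<in> topspace X \<Longrightarrow> f x \<in> M"
    and "\<And>x r. x \<in> topspace X \<Longrightarrow> r > 0 \<Longrightarrow>
      \<exists>U. openin X U \<and> x \<in> U \<and> (\<forall>y\<in>U. d (f x) (f y) < ereal r)"
  shows "continuous_map X (pseudometric_topology M d) f"
  unfolding continuous_map topspace_pseudometric_topology
proof (intro conjI allI impI)
  show "f ` topspace X \<subseteq> M" using assms(1) by blast
  fix W assume W: "openin (pseudometric_topology M d) W"
  show "openin X {x \<in> topspace X. f x \<in> W}"
  proof (subst openin_subopen, intro ballI)
    fix x assume "x \<in> {x \<in> topspace X. f x \<in> W}"
    then have x: "x \<in> topspace X" "f x \<in> W" by auto
    obtain r where r: "r > 0" "{y \<in> M. d (f x) y < ereal r} \<subseteq> W"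
      using W x(2) unfolding openin_pseudometric_topology by blast
    obtain U where U: "openin X U" "x \<in> U" "\<forall>y\<in>U. d (f x) (f y) < ereal r"
      using assms(2)[OF x(1) r(1)] by blast
    have "U \<subseteq> {x \<in> topspace X. f x \<in> W}"
      using openin_subset[OF U(1)] U(3) r(2) assms(1) by blast
    with U show "\<exists>T. openin X T \<and> x \<in> T \<and> T \<subseteq> {x \<in> topspace X. f x \<in> W}" by blast
  qed
qed

text \<open>Asking for a point of \<open>A\<close>, rather than for infimal distance at most
  \<open>s\<close>, makes radius 0 return \<open>A\<close> itself and not its closure.\<close>

definition thicken :: "real \<Rightarrow> 'a::metric_space set \<Rightarrow> 'a set" where
  "thicken s A = {x. \<exists>a\<in>A. dist x a \<le> s}"

lemma thicken_0 [simp]: "thicken 0 A = A"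
  by (auto simp: thicken_def)

lemma thicken_eq_UNIV: "eps_net \<epsilon> A \<Longrightarrow> \<epsilon> \<le> s \<Longrightarrow> thicken s A = UNIV"
  unfolding thicken_def eps_net_def by (blast intro: order_trans)

lemma nets_mono: "A \<in> nets \<Longrightarrow> A \<subseteq> B \<Longrightarrow> B \<in> nets"
  unfolding nets_def eps_net_def by blast

lemma subset_thicken: "0 \<le> s \<Longrightarrow> A \<subseteq> thicken s A"
  by (force simp: thicken_def)

text \<open>The linear structure enters here: the displacement \<open>x - a\<close> is carried over
  from \<open>a\<close> to a nearby \<open>b\<close> and shortened to length at most
  \<open>t\<close>.\<close>

lemma thicken_close:
  fixes A B :: "'a::real_normed_vector set"
  assumes "0 \<le> s" "0 \<le> t" "hausdorff_dist A B < ereal e" "x \<in> thicken s A"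
  shows "\<exists>y\<in>thicken t B. dist x y \<le> e + \<bar>s - t\<bar>"
proof -
  obtain a where a: "a \<in> A" "norm (x - a) \<le> s"
    using assms(4) by (auto simp: thicken_def dist_norm)
  obtain b where b: "b \<in> B" "norm (a - b) < e"
    using hausdorff_dist_lessD[OF assms(3) a(1)] by (auto simp: dist_norm)
  define c where "c = (if s \<le> t then 1 else t / s)"
  define y where "y = b + c *\<^sub>R (x - a)"
  have c: "0 \<le> c" "c \<le> 1" "c * s \<le> t" "(1 - c) * s \<le> \<bar>s - t\<bar>"
    using assms(1,2) by (auto simp: c_def field_simps)
  have "norm (y - b) = c * norm (x - a)"
    using c(1) by (simp add: y_def)
  also have "\<dots> \<le> c * s" using a(2) c(1) by (rule mult_left_mono)
  finally have "y \<in> thicken t B"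
    using b(1) c(3) by (auto simp: thicken_def dist_norm intro: order_trans)
  moreover have "dist x y \<le> e + \<bar>s - t\<bar>"
  proof -
    have "x - y = (a - b) + (1 - c) *\<^sub>R (x - a)"
      by (simp add: y_def algebra_simps)
    then have "norm (x - y) \<le> norm (a - b) + (1 - c) * norm (x - a)"
      using norm_triangle_ineq[of "a - b" "(1 - c) *\<^sub>R (x - a)"] c(2) by simp
    also have "(1 - c) * norm (x - a) \<le> (1 - c) * s"
      using a(2) c(2) by (intro mult_left_mono) auto
    finally show ?thesis using b(2) c(4) by (simp add: dist_norm)
  qed
  ultimately show ?thesis by blast
qed

lemma hausdorff_dist_thicken_le:
  fixes A B :: "'a::real_normed_vector set"
  assumes "0 \<le> s" "0 \<le> t" "hausdorff_dist A B < ereal e"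
  shows "hausdorff_dist (thicken s A) (thicken t B) \<le> ereal (e + \<bar>s - t\<bar>)"
proof (rule hausdorff_dist_le)
  show "\<exists>y\<in>thicken t B. dist x y \<le> e + \<bar>s - t\<bar>" if "x \<in> thicken s A" for x
    using thicken_close[OF assms that] .
  show "\<exists>x\<in>thicken s A. dist y x \<le> e + \<bar>s - t\<bar>" if "y \<in> thicken t B" for y
    using thicken_close[OF assms(2,1) _ that, of A e] assms(3)
    by (simp add: hausdorff_dist_commute abs_minus_commute)
qed

text \<open>Makes the covering radius uniform on a ball about \<open>A\<close>, as continuity at
  infinite radius requires.\<close>

lemma eps_net_hausdorff_dist:
  assumes "eps_net \<epsilon> A" "hausdorff_dist A B < ereal r"
  shows "eps_net (\<epsilon> + r) B"
proof -
  have "\<exists>b\<in>B. dist x b \<le> \<epsilon> + r" for x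
  proof -
    obtain a where a: "a \<in> A" "dist x a \<le> \<epsilon>" using assms(1) by (auto simp: eps_net_def)
    obtain b where b: "b \<in> B" "dist a b < r" using hausdorff_dist_lessD[OF assms(2) a(1)] by blast
    show ?thesis using a b dist_triangle[of x b a] by (intro bexI[of _ b]) auto
  qed
  then show ?thesis by (auto simp: eps_net_def)
qed

text \<open>The map \<open>t / (1 - t)\<close> carries [0,1) increasingly onto the radii from 0 to
  infinity. The case \<open>t = 1\<close> must be separate: division by zero would give radius 0
  there.\<close>

definition thicken_homotopy :: "real \<times> 'a::metric_space set \<Rightarrow> 'a set" where
  "thicken_homotopy = (\<lambda>(t, A). if t < 1 then thicken (t / (1 - t)) A else UNIV)"

text \<open>Joint continuity at \<open>(t, A)\<close>. For \<open>t < 1\<close> it follows from the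
  thickening estimate and continuity of the radius; at \<open>t = 1\<close> nearby values are all
  \<open>UNIV\<close>.\<close>

lemma thicken_homotopy_near:
  fixes A :: "'a::real_normed_vector set"
  assumes "t \<in> {0..1}" "A \<in> nets" "r > 0"
  shows "\<exists>T \<delta>. open T \<and> t \<in> T \<and> \<delta> > 0 \<and>
    (\<forall>u\<in>T \<inter> {0..1}. \<forall>B. hausdorff_dist A B < ereal \<delta> \<longrightarrow>
      hausdorff_dist (thicken_homotopy (t, A)) (thicken_homotopy (u, B)) < ereal r)"
proof (cases "t < 1")
  case True
  define s where "s u = u / (1 - u)" for u :: real
  \<comment> \<open>One third of \<open>r\<close> is for the change of radius, one for the change of
    net; the last keeps the final bound strict.\<close>
  define T where "T = s -` ball (s t) (r / 3) \<inter> {..<1}"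
  have "continuous_on {..<1} s"
    unfolding s_def by (intro continuous_intros) auto
  then have "open T"
    unfolding T_def by (metis continuous_on_open_vimage open_ball open_lessThan)
  moreover have "t \<in> T" using True assms(3) by (simp add: T_def)
  moreover have "hausdorff_dist (thicken_homotopy (t, A)) (thicken_homotopy (u, B)) < ereal r"
    if "u \<in> T \<inter> {0..1}" "hausdorff_dist A B < ereal (r / 3)" for u B
  proof -
    have "0 \<le> s t" "0 \<le> s u" "u < 1" "\<bar>s t - s u\<bar> < r / 3"
      using that(1) True assms(1) by (auto simp: s_def T_def dist_real_def)
    then show ?thesis
      using hausdorff_dist_thicken_le[of "s t" "s u" A B "r / 3"] that(2) True assms(3)
      by (auto simp: thicken_homotopy_def s_def intro: le_less_trans)
  qed
  ultimately show ?thesis using assms(3) by (intro exI[of _ T] exI[of _ "r / 3"]) auto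
next
  case False
  obtain e where e: "e > 0" "eps_net e A" using assms(2) by (auto simp: nets_def)
  \<comment> \<open>For \<open>u < 1\<close>, \<open>u > (e + 1) / (e + 2)\<close> is equivalent to
    \<open>u / (1 - u) > e + 1\<close>, a radius at which every net within distance 1 of
    \<open>A\<close> fills the space.\<close>
  define T where "T = {(e + 1) / (e + 2)<..}"
  have "hausdorff_dist (thicken_homotopy (t, A)) (thicken_homotopy (u, B)) < ereal r"
    if "u \<in> T" "hausdorff_dist A B < ereal 1" for u B
  proof -
    have "thicken (u / (1 - u)) B = UNIV" if "u < 1"
    proof (rule thicken_eq_UNIV)
      show "eps_net (e + 1) B" using e(2) \<open>hausdorff_dist A B < ereal 1\<close> by (rule eps_net_hausdorff_dist)
      show "e + 1 \<le> u / (1 - u)" using \<open>u \<in> T\<close> that e(1) by (simp add: T_def field_simps)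
    qed
    then have "thicken_homotopy (u, B) = UNIV" by (simp add: thicken_homotopy_def)
    moreover have "thicken_homotopy (t, A) = UNIV" using False by (simp add: thicken_homotopy_def)
    moreover have "hausdorff_dist (UNIV :: 'a set) UNIV \<le> ereal 0"
      by (rule hausdorff_dist_le) (auto intro: exI[of _ x for x])
    ultimately show ?thesis using assms(3) by (auto intro: le_less_trans)
  qed
  moreover have "t \<in> T" using False assms(1) e(1) by (auto simp: T_def)
  moreover have "open T" by (simp add: T_def)
  ultimately show ?thesis by (intro exI[of _ T] exI[of _ 1]) auto
qed

text \<open>The homotopy only enlarges sets, and supersets of nets are nets.\<close>

lemma thicken_homotopy_in_nets:
  assumes "0 \<le> t" "A \<in> nets"
  shows "thicken_homotopy (t, A) \<in> nets"
proof (rule nets_mono[OF assms(2)])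
  show "A \<subseteq> thicken_homotopy (t, A)"
    using assms(1) subset_thicken[of "t / (1 - t)" A] by (simp add: thicken_homotopy_def)
qed

lemma continuous_map_thicken_homotopy:
  "continuous_map (prod_topology (top_of_set {0..1}) Net_H) Net_H
     (thicken_homotopy :: real \<times> 'a::real_normed_vector set \<Rightarrow> 'a set)"
    (is "continuous_map ?X _ _")
proof (subst (2) Net_H_def, rule continuous_map_into_pseudometric_topology)
  show "thicken_homotopy x \<in> nets" if "x \<in> topspace ?X" for x :: "real \<times> 'a set"
    using that thicken_homotopy_in_nets[of "fst x" "snd x"] by auto
  show "\<exists>U. openin ?X U \<and> x \<in> U \<and>
      (\<forall>y\<in>U. hausdorff_dist (thicken_homotopy x) (thicken_homotopy y) < ereal r)"
    if xr: "x \<in> topspace ?X" "r > 0" for x :: "real \<times> 'a set" and r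
  proof -
    obtain t A where x: "x = (t, A)" "t \<in> {0..1}" "A \<in> nets"
      using xr(1) by auto
    obtain T \<delta> where T: "open T" "t \<in> T" "\<delta> > 0"
      "\<And>u B. u \<in> T \<inter> {0..1} \<Longrightarrow> hausdorff_dist A B < ereal \<delta> \<Longrightarrow>
        hausdorff_dist (thicken_homotopy (t, A)) (thicken_homotopy (u, B)) < ereal r"
      using thicken_homotopy_near[OF x(2,3) xr(2)] by blast
    define U where "U = ({0..1} \<inter> T) \<times> {B \<in> nets. hausdorff_dist A B < ereal \<delta>}"
    have "hausdorff_dist A A \<le> ereal 0" by (rule hausdorff_dist_le) force+
    then have "hausdorff_dist A A < ereal \<delta>" using T(3) by (auto intro: le_less_trans)
    then have "x \<in> U" using x T(2) by (simp add: U_def)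
    moreover have "openin ?X U"
      unfolding U_def openin_prod_Times_iff using T(1) openin_Net_H_ball by (auto intro: openin_open_Int)
    ultimately show ?thesis using T(4) x(1) by (intro exI[of _ U]) (auto simp: U_def)
  qed
qed

theorem proposition3:
  assumes "\<exists>B::'a::real_normed_vector set. finite B \<and> span B = UNIV"
  shows "contractible_space (Net_H :: 'a set topology)"
proof -
  \<comment> \<open>At time 0 the radius is \<open>0 / (1 - 0) = 0\<close>, which gives the
    identity.\<close>
  have "homotopic_with (\<lambda>_. True) (Net_H :: 'a set topology) Net_H id (\<lambda>_. UNIV)"
    unfolding homotopic_with_def
    by (intro exI[of _ thicken_homotopy] conjI continuous_map_thicken_homotopy)
      (auto simp: thicken_homotopy_def)
  then show ?thesis unfolding contractible_space_def by blast
qed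

end
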